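(* Let $G=(V,E)$ be a finite connected directed graph with edge costs $c\in\mathbb{R}_+^{|E|}$ and incidence matrix $D$, and let $f=\rho_1-\rho_0$ with $\rho_0,\rho_1\in\mathrm{Prob}(V)$ be such that $\{J\in\mathbb{R}^{|E|}: J\ge 0,\ D^\top J=f\}$ is nonempty. Then there exists a constant $\tilde\alpha>0$, depending on the graph $G$ (with its edge costs) and the data $f$, such that for all $\alpha\in(0,\tilde\alpha)$ the solution $J^\alpha$ of (QP) with parameter $\alpha$ is also a solution of (LP).
   Context: $G=(V,E)$ is a finite connected graph with directed edges $E\subseteq V\times V$ without self-loops. $\mathrm{Prob}(V)=\{\rho\in\mathbb{R}^{|V|}:\mathbb{1}^\top\rho=1,\ \rho\ge 0\}$. The incidence matrix $D\in\{-1,0,1\}^{|E|\times|V|}$ has entries $D_{ev}=-1$ if $e=(v,w)$ for some $w\in V$, $D_{ev}=1$ if $e=(w,v)$ for some $w\in V$, and $D_{ev}=0$ otherwise. Vector inequalities are entrywise and $|\cdot|$ is the Euclidean norm. (LP) is the problem of minimizing $c^\top J$ over $J\in\mathbb{R}^{|E|}$ subject to $J\ge 0$ and $D^\top J=f$; a solution of (LP) is any minimizer (not necessarily unique). For $\alpha>0$, (QP) with parameter $\alpha$ is the problem of minimizing $c^\top J+\frac{\alpha}{2}|J|^2$ over $J\in\mathbb{R}^{|E|}$ subject to $J\ge 0$ and $D^\top J=f$; its solution, unique by strict convexity, is denoted $J^\alpha$. *)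

theory Defs
  imports "HOL-Analysis.Analysis" "Graph_Theory.Digraph_Component" "Graph_Theory.Pair_Digraph"
begin

text \<open>
  A vector in \<open>\<real>\<^sup>|\<^sup>I\<^sup>|\<close> is represented by an extensional function on the finite index
  set \<open>I\<close>, i.e. an element of \<open>I \<rightarrow>\<^sub>E UNIV\<close>.  Explicit carriers are used instead of index types because
  the edge set may be empty (one vertex, no edges).
\<close>

definition Prob :: "'v set \<Rightarrow> ('v \<Rightarrow> real) set" where
  "Prob V = {\<rho> \<in> V \<rightarrow>\<^sub>E UNIV. (\<Sum>v\<in>V. \<rho> v) = 1 \<and> (\<forall>v\<in>V. 0 \<le> \<rho> v)}"

definition incidence :: "'v pair_pre_digraph \<Rightarrow> 'v \<times> 'v \<Rightarrow> 'v \<Rightarrow> real" where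
  "incidence G e v =
    (if \<exists>w\<in>pverts G. e = (v, w) then - 1
     else if \<exists>w\<in>pverts G. e = (w, v) then 1
     else 0)"

definition feasible_flows :: "'v pair_pre_digraph \<Rightarrow> ('v \<Rightarrow> real) \<Rightarrow> ('v \<times> 'v \<Rightarrow> real) set" where
  "feasible_flows G f =
    {J \<in> parcs G \<rightarrow>\<^sub>E UNIV. (\<forall>e\<in>parcs G. 0 \<le> J e) \<and>
       (\<forall>v\<in>pverts G. (\<Sum>e\<in>parcs G. incidence G e v * J e) = f v)}"

definition lp_objective :: "'v pair_pre_digraph \<Rightarrow> ('v \<times> 'v \<Rightarrow> real) \<Rightarrow> ('v \<times> 'v \<Rightarrow> real) \<Rightarrow> real" where
  "lp_objective G c J = (\<Sum>e\<in>parcs G. c e * J e)"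

definition qp_objective ::
  "'v pair_pre_digraph \<Rightarrow> ('v \<times> 'v \<Rightarrow> real) \<Rightarrow> real \<Rightarrow> ('v \<times> 'v \<Rightarrow> real) \<Rightarrow> real" where
  "qp_objective G c \<alpha> J = lp_objective G c J + \<alpha> / 2 * (L2_set J (parcs G))\<^sup>2"

definition lp_solution ::
  "'v pair_pre_digraph \<Rightarrow> ('v \<times> 'v \<Rightarrow> real) \<Rightarrow> ('v \<Rightarrow> real) \<Rightarrow> ('v \<times> 'v \<Rightarrow> real) \<Rightarrow> bool" where
  "lp_solution G c f J \<longleftrightarrow> is_arg_min (lp_objective G c) (\<lambda>J. J \<in> feasible_flows G f) J"

definition qp_solution ::
  "'v pair_pre_digraph \<Rightarrow> ('v \<times> 'v \<Rightarrow> real) \<Rightarrow> ('v \<Rightarrow> real) \<Rightarrow> real \<Rightarrow> ('v \<times> 'v \<Rightarrow> real) \<Rightarrow> bool" where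
  "qp_solution G c f \<alpha> J \<longleftrightarrow> is_arg_min (qp_objective G c \<alpha>) (\<lambda>J. J \<in> feasible_flows G f) J"

text \<open>
  For \<open>\<alpha> > 0\<close>, nonnegative costs and a nonempty feasible set the minimizer exists and is unique,
  see \<open>ex1_qp_solution\<close> below.
\<close>

definition qp_flow ::
  "'v pair_pre_digraph \<Rightarrow> ('v \<times> 'v \<Rightarrow> real) \<Rightarrow> ('v \<Rightarrow> real) \<Rightarrow> real \<Rightarrow> 'v \<times> 'v \<Rightarrow> real" where
  "qp_flow G c f \<alpha> = (THE J. qp_solution G c f \<alpha> J)"

lemma qp_objective_altdef:
  "qp_objective G c \<alpha> J = (\<Sum>e\<in>parcs G. c e * J e) + \<alpha> / 2 * (\<Sum>e\<in>parcs G. (J e)\<^sup>2)"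
  by (simp add: qp_objective_def lp_objective_def L2_set_def sum_nonneg)

lemma qp_solution_le_1:
  assumes fin: "finite (parcs G)" and \<alpha>: "\<alpha> > 0"
    and J: "qp_solution G c f \<alpha> J" and K: "qp_solution G c f \<alpha> K"
  shows "J = K"
proof -
  define M where "M = (\<lambda>e\<in>parcs G. (J e + K e) / 2)"
  define S where "S = (\<Sum>e\<in>parcs G. (J e - K e)\<^sup>2)"
  have JF: "J \<in> feasible_flows G f" and KF: "K \<in> feasible_flows G f"
    using J K by (auto simp: qp_solution_def is_arg_min_def)
  have sumM: "(\<Sum>e\<in>parcs G. a e * M e) = ((\<Sum>e\<in>parcs G. a e * J e) + (\<Sum>e\<in>parcs G. a e * K e)) / 2"
    for a :: "'a \<times> 'a \<Rightarrow> real"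
  proof -
    have "(\<Sum>e\<in>parcs G. a e * M e) = (\<Sum>e\<in>parcs G. (a e * J e + a e * K e) / 2)"
      by (intro sum.cong) (auto simp: M_def algebra_simps)
    also have "\<dots> = ((\<Sum>e\<in>parcs G. a e * J e) + (\<Sum>e\<in>parcs G. a e * K e)) / 2"
      by (simp only: sum.distrib flip: sum_divide_distrib)
    finally show ?thesis .
  qed
  have "M \<in> feasible_flows G f"
    using JF KF unfolding feasible_flows_def mem_Collect_eq sumM by (auto simp: M_def)
  then have le: "qp_objective G c \<alpha> J \<le> qp_objective G c \<alpha> M" "qp_objective G c \<alpha> K \<le> qp_objective G c \<alpha> M"
    using J K by (auto simp: qp_solution_def is_arg_min_linorder)
  have "(\<Sum>e\<in>parcs G. (M e)\<^sup>2) = (\<Sum>e\<in>parcs G. ((J e)\<^sup>2 + (K e)\<^sup>2) / 2 - (J e - K e)\<^sup>2 / 4)"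
    by (intro sum.cong) (auto simp: M_def power2_eq_square field_simps)
  also have "\<dots> = ((\<Sum>e\<in>parcs G. (J e)\<^sup>2) + (\<Sum>e\<in>parcs G. (K e)\<^sup>2)) / 2 - S / 4"
    unfolding S_def by (simp only: sum_subtractf sum.distrib flip: sum_divide_distrib)
  finally have sq: "(\<Sum>e\<in>parcs G. (M e)\<^sup>2)
      = ((\<Sum>e\<in>parcs G. (J e)\<^sup>2) + (\<Sum>e\<in>parcs G. (K e)\<^sup>2)) / 2 - S / 4" .
  have alg: "(a + b) / 2 + \<alpha> / 2 * ((x + y) / 2 - z / 4)
      = ((a + \<alpha> / 2 * x) + (b + \<alpha> / 2 * y)) / 2 - \<alpha> * z / 8" for a b x y z :: real
    by (simp add: field_simps)
  have "qp_objective G c \<alpha> M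
      = (qp_objective G c \<alpha> J + qp_objective G c \<alpha> K) / 2 - \<alpha> * S / 8"
    unfolding qp_objective_altdef sumM sq by (rule alg)
  moreover have "t \<le> 0" if "a \<le> m" "b \<le> m" "m = (a + b) / 2 - t / 8" for a b m t :: real
    using that by (simp add: field_simps)
  ultimately have "\<alpha> * S \<le> 0" using le by blast
  then have "S \<le> 0" using \<alpha> by (simp add: mult_le_0_iff)
  moreover have "S \<ge> 0" by (simp add: S_def sum_nonneg)
  ultimately have "S = 0" by simp
  then have "\<forall>e\<in>parcs G. J e = K e"
    unfolding S_def using fin by (subst (asm) sum_nonneg_eq_0_iff) auto
  then show "J = K"
    using JF KF by (intro PiE_ext[of J "parcs G" "\<lambda>_. UNIV" K]) (auto simp: feasible_flows_def)
qed

lemma ex_qp_solution: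
  assumes fin: "finite (parcs G)" and c: "\<forall>e\<in>parcs G. 0 \<le> c e" and \<alpha>: "\<alpha> > 0"
    and ne: "feasible_flows G f \<noteq> {}"
  shows "\<exists>J. qp_solution G c f \<alpha> J"
proof -
  define E where "E = parcs G"
  define q where "q = qp_objective G c \<alpha>"
  define X where "X = product_topology (\<lambda>e::'a \<times> 'a. euclideanreal) E"
  from ne obtain J0 where J0: "J0 \<in> feasible_flows G f" by blast
  define B where "B = 1 + 2 * q J0 / \<alpha>"
  define C where "C = {J \<in> E \<rightarrow>\<^sub>E {0..B}. \<forall>v\<in>pverts G. (\<Sum>e\<in>E. incidence G e v * J e) = f v}"
  define T where "T v = {J \<in> topspace X. (\<Sum>e\<in>E. incidence G e v * J e) \<in> {f v}}" for v
  have finE: "finite E" using fin by (simp add: E_def)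
  have bound: "J \<in> C" if J: "J \<in> feasible_flows G f" and le: "q J \<le> q J0" for J
  proof -
    have pos: "\<forall>e\<in>E. 0 \<le> J e" using J by (auto simp: feasible_flows_def E_def)
    have "J e \<le> B" if e: "e \<in> E" for e
    proof -
      have "(J e)\<^sup>2 \<le> (\<Sum>e\<in>E. (J e)\<^sup>2)" using finE e by (intro member_le_sum) auto
      moreover have "0 \<le> (\<Sum>e\<in>E. c e * J e)" using c pos by (intro sum_nonneg) (auto simp: E_def)
      then have "\<alpha> / 2 * (\<Sum>e\<in>E. (J e)\<^sup>2) \<le> q J0"
        using le unfolding q_def qp_objective_altdef[of _ _ _ J] E_def by linarith
      then have "(\<Sum>e\<in>E. (J e)\<^sup>2) \<le> 2 * q J0 / \<alpha>" using \<alpha> by (simp add: field_simps)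
      moreover have "J e \<le> 1 + (J e)\<^sup>2"
        using zero_le_power2[of "J e - 1 / 2"] by (simp add: power2_diff power_divide)
      ultimately show ?thesis unfolding B_def by linarith
    qed
    with J pos show ?thesis by (auto simp: C_def feasible_flows_def E_def PiE_iff)
  qed
  have cont: "continuous_map X euclideanreal (\<lambda>J. J e)" if "e \<in> E" for e
    unfolding X_def using continuous_map_product_projection[OF that, of "\<lambda>e. euclideanreal"] by simp
  have contlin: "continuous_map X euclideanreal (\<lambda>J. \<Sum>e\<in>E. a e * J e)" for a :: "'a \<times> 'a \<Rightarrow> real"
    using finE by (intro continuous_map_sum continuous_map_real_mult_left cont)
  have contq: "continuous_map X euclideanreal q"
  proof -
    have "q = (\<lambda>J. (\<Sum>e\<in>E. c e * J e) + \<alpha> / 2 * (\<Sum>e\<in>E. (J e)\<^sup>2))"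
      by (auto simp: q_def E_def qp_objective_altdef)
    moreover have "continuous_map X euclideanreal (\<lambda>J. (\<Sum>e\<in>E. c e * J e) + \<alpha> / 2 * (\<Sum>e\<in>E. (J e)\<^sup>2))"
      using finE
      by (intro continuous_map_add contlin continuous_map_real_mult_left continuous_map_sum
          continuous_map_real_pow cont)
    ultimately show ?thesis by simp
  qed
  have "compactin X (E \<rightarrow>\<^sub>E {0..B})"
    unfolding X_def by (simp add: compactin_PiE)
  moreover have "closedin X (\<Inter>(insert (topspace X) (T ` pverts G)))"
  proof (rule closedin_Inter)
    have "closedin X (T v)" for v
      unfolding T_def by (intro closedin_continuous_map_preimage[OF contlin]) simp
    then show "closedin X S" if "S \<in> insert (topspace X) (T ` pverts G)" for S
      using that by auto
  qed simp
  moreover have "C = (E \<rightarrow>\<^sub>E {0..B}) \<inter> \<Inter>(insert (topspace X) (T ` pverts G))"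
  proof -
    have "E \<rightarrow>\<^sub>E {0..B} \<subseteq> topspace X" by (simp add: X_def PiE_mono)
    then show ?thesis unfolding C_def T_def by blast
  qed
  ultimately have "compactin X C"
    by (metis Int_commute closed_Int_compactin)
  then have "compact (q ` C)"
    using image_compactin[OF _ contq] by simp
  moreover have J0C: "J0 \<in> C" using bound[OF J0] by simp
  ultimately obtain J where J: "J \<in> C" and min: "\<forall>K\<in>C. q J \<le> q K"
    using compact_attains_inf[of "q ` C"] by auto
  have "J \<in> feasible_flows G f"
    using J by (auto simp: C_def feasible_flows_def E_def PiE_iff)
  moreover have "q J \<le> q K" if "K \<in> feasible_flows G f" for K
    using min bound[OF that] J0C by (meson le_cases order_trans)
  ultimately show ?thesis
    unfolding qp_solution_def is_arg_min_linorder q_def by blast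
qed

lemma ex1_qp_solution:
  assumes "finite (parcs G)" and "\<forall>e\<in>parcs G. 0 \<le> c e" and "\<alpha> > 0" and "feasible_flows G f \<noteq> {}"
  shows "\<exists>!J. qp_solution G c f \<alpha> J"
  using ex_qp_solution[OF assms] qp_solution_le_1[OF assms(1,3)] by blast

end

theory Submission
  imports Defs
begin

text \<open>
  The idea is to play the first-order optimality condition of the quadratic problem against a
  finite choice of descent directions of the linear one.

  Whether a flow \<open>J\<close> can be improved in the linear problem depends on \<open>J\<close> only through its
  support \<open>S\<close>: if a cheaper feasible flow \<open>K\<close> exists, then \<open>d = K - J\<close> is divergence-free,
  nonnegative off \<open>S\<close>, and \<open>c \<bullet> d < 0\<close>; these conditions on \<open>d\<close> involve \<open>S\<close> but not \<open>J\<close>. As there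
  are finitely many supports, one such \<open>d\<close> can be fixed for every \<open>S\<close> that admits one
  (\<open>cheaper_flow_difference_is_direction\<close>).

  On the other hand, the quadratic minimizer \<open>J\<close> for the parameter \<open>\<alpha>\<close> satisfies
  \<open>c \<bullet> d + \<alpha> (J \<bullet> d) \<ge> 0\<close> for each of these directions when \<open>S\<close> is its own support
  (\<open>qp_first_order\<close>). The perturbation \<open>\<alpha> (J \<bullet> d)\<close> vanishes as \<open>\<alpha>\<close> tends to \<open>0\<close>, because the
  energy \<open>\<alpha> / 2 * |J|\<^sup>2\<close> stays bounded by the objective value of any feasible competitor,
  so that \<open>\<alpha> |J|\<close> is at most of order \<open>sqrt \<alpha>\<close> (\<open>scaled_qp_flow_tendsto_0\<close>). Hence a fixed \<open>d\<close>
  with \<open>c \<bullet> d < 0\<close> violates the condition for all small \<open>\<alpha>\<close>, and the minimum of the finitely many thresholds is the required constant.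
\<close>

text \<open>
  The cone of directions in which a flow with support \<open>S\<close> can be perturbed and stay feasible.
  It is parametrised by the support rather than by the flow, so that only finitely many cones occur.
\<close>

definition flow_directions ::
  "'v pair_pre_digraph \<Rightarrow> ('v \<times> 'v) set \<Rightarrow> ('v \<times> 'v \<Rightarrow> real) set" where
  "flow_directions G S =
    {d. (\<forall>v\<in>pverts G. (\<Sum>e\<in>parcs G. incidence G e v * d e) = 0) \<and> (\<forall>e\<in>parcs G - S. 0 \<le> d e)}"

definition flow_support :: "'v pair_pre_digraph \<Rightarrow> ('v \<times> 'v \<Rightarrow> real) \<Rightarrow> ('v \<times> 'v) set" where
  "flow_support G J = {e \<in> parcs G. 0 < J e}"

lemma cheaper_flow_difference_is_direction:
  assumes "J \<in> feasible_flows G f" and "\<not> lp_solution G c f J"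
  obtains d where "d \<in> flow_directions G (flow_support G J)" and "(\<Sum>e\<in>parcs G. c e * d e) < 0"
proof -
  obtain K where K: "K \<in> feasible_flows G f" and less: "lp_objective G c K < lp_objective G c J"
    using assms by (auto simp: lp_solution_def is_arg_min_def)
  show ?thesis
  proof (rule that[of "\<lambda>e. K e - J e"])
    show "(\<lambda>e. K e - J e) \<in> flow_directions G (flow_support G J)"
      using assms(1) K
      by (force simp: flow_directions_def flow_support_def feasible_flows_def
          right_diff_distrib sum_subtractf)
    show "(\<Sum>e\<in>parcs G. c e * (K e - J e)) < 0"
      using less by (simp add: lp_objective_def right_diff_distrib sum_subtractf)
  qed
qed

text \<open>
  On the support the flow is positive and hence tolerates a small change of either sign;
  off the support it is zero and the direction is nonnegative.
\<close>

lemma eventually_perturbed_flow_feasible: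
  assumes fin: "finite (parcs G)" and J: "J \<in> feasible_flows G f"
    and d: "d \<in> flow_directions G (flow_support G J)"
  shows "\<forall>\<^sub>F t in at_right 0. (\<lambda>e\<in>parcs G. J e + t * d e) \<in> feasible_flows G f"
proof -
  have "\<forall>\<^sub>F t in at_right 0. 0 \<le> J e + t * d e" if e: "e \<in> parcs G" for e
  proof (cases "e \<in> flow_support G J")
    case True
    have "((\<lambda>t. J e + t * d e) \<longlongrightarrow> J e + 0 * d e) (at_right 0)"
      by (intro tendsto_intros)
    then show ?thesis
      using True order_tendstoD(1)[of "\<lambda>t. J e + t * d e" "J e" "at_right 0" 0]
      by (auto simp: flow_support_def elim: eventually_mono)
  next
    case False
    then have "0 \<le> J e" "0 \<le> d e"
      using J d e by (auto simp: flow_directions_def feasible_flows_def)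
    then show ?thesis
      by (intro eventually_mono[OF eventually_at_right_less[of 0]]) simp
  qed
  then have "\<forall>\<^sub>F t in at_right 0. \<forall>e\<in>parcs G. 0 \<le> J e + t * d e"
    using fin by (intro eventually_ball_finite) auto
  then show ?thesis
  proof eventually_elim
    case (elim t)
    have "(\<Sum>e\<in>parcs G. incidence G e v * (J e + t * d e)) =
        (\<Sum>e\<in>parcs G. incidence G e v * J e) + t * (\<Sum>e\<in>parcs G. incidence G e v * d e)" for v
      by (simp add: algebra_simps sum.distrib sum_distrib_left)
    with elim J d show ?case
      by (simp add: feasible_flows_def flow_directions_def)
  qed
qed

lemma qp_objective_perturbed:
  "qp_objective G c \<alpha> (\<lambda>e\<in>parcs G. J e + t * d e) =
    qp_objective G c \<alpha> J +
    t * ((\<Sum>e\<in>parcs G. c e * d e) + \<alpha> * (\<Sum>e\<in>parcs G. J e * d e) +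
      t * (\<alpha> / 2 * (\<Sum>e\<in>parcs G. (d e)\<^sup>2)))"
proof -
  have "(\<Sum>e\<in>parcs G. c e * (J e + t * d e)) =
      (\<Sum>e\<in>parcs G. c e * J e) + t * (\<Sum>e\<in>parcs G. c e * d e)"
    by (simp add: algebra_simps sum.distrib sum_distrib_left)
  moreover have "(\<Sum>e\<in>parcs G. (J e + t * d e)\<^sup>2) =
      (\<Sum>e\<in>parcs G. (J e)\<^sup>2) + 2 * t * (\<Sum>e\<in>parcs G. J e * d e) + t\<^sup>2 * (\<Sum>e\<in>parcs G. (d e)\<^sup>2)"
    by (simp add: power2_sum power_mult_distrib sum.distrib sum_distrib_left mult_ac)
  ultimately show ?thesis
    by (simp add: qp_objective_altdef algebra_simps power2_eq_square)
qed

text \<open>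
  The right-hand side is the one-sided directional derivative of the quadratic objective. No bound
  on the admissible step length enters, so nothing is lost when entries of \<open>J\<close> are tiny.
\<close>

lemma qp_first_order:
  assumes fin: "finite (parcs G)" and J: "qp_solution G c f \<alpha> J"
    and d: "d \<in> flow_directions G (flow_support G J)"
  shows "0 \<le> (\<Sum>e\<in>parcs G. c e * d e) + \<alpha> * (\<Sum>e\<in>parcs G. J e * d e)" (is "0 \<le> ?D")
proof -
  define N where "N = \<alpha> / 2 * (\<Sum>e\<in>parcs G. (d e)\<^sup>2)"
  have JF: "J \<in> feasible_flows G f"
    and min: "\<And>K. K \<in> feasible_flows G f \<Longrightarrow> qp_objective G c \<alpha> J \<le> qp_objective G c \<alpha> K"
    using J by (auto simp: qp_solution_def is_arg_min_linorder)
  have "\<forall>\<^sub>F t in at_right 0. 0 \<le> ?D + t * N"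
    using eventually_perturbed_flow_feasible[OF fin JF d] eventually_at_right_less[of 0]
  proof eventually_elim
    case (elim t)
    with min[OF elim(1)] show ?case
      by (simp add: qp_objective_perturbed zero_le_mult_iff N_def)
  qed
  moreover have "((\<lambda>t. ?D + t * N) \<longlongrightarrow> ?D + 0 * N) (at_right 0)"
    by (intro tendsto_intros)
  ultimately show ?thesis
    using tendsto_lowerbound[of "\<lambda>t. ?D + t * N" ?D "at_right 0" 0] by simp
qed

lemma qp_solution_qp_flow:
  assumes "finite (parcs G)" and "\<forall>e\<in>parcs G. 0 \<le> c e" and "\<alpha> > 0" and "feasible_flows G f \<noteq> {}"
  shows "qp_solution G c f \<alpha> (qp_flow G c f \<alpha>)"
  unfolding qp_flow_def by (rule theI'[OF ex1_qp_solution[OF assms]])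

text \<open>
  Let \<open>C\<close> be the cost and \<open>2 * M\<close> the squared norm of a fixed feasible flow \<open>J0\<close>. Comparing the
  minimizer \<open>J\<close> with \<open>J0\<close> gives \<open>\<alpha> / 2 * (J e)\<^sup>2 \<le> C + \<alpha> * M\<close> for each edge \<open>e\<close>, and multiplication
  by \<open>2 * \<alpha>\<close> turns this into a bound on \<open>(\<alpha> * J e)\<^sup>2\<close> that vanishes with \<open>\<alpha>\<close>. Choosing \<open>J0\<close> to
  minimize the linear problem would bound \<open>J\<close> itself, but only once such a minimizer is known to exist.
\<close>

lemma scaled_qp_flow_tendsto_0:
  assumes fin: "finite (parcs G)" and c: "\<forall>e\<in>parcs G. 0 \<le> c e"
    and ne: "feasible_flows G f \<noteq> {}" and e: "e \<in> parcs G"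
  shows "((\<lambda>\<alpha>. \<alpha> * qp_flow G c f \<alpha> e) \<longlongrightarrow> 0) (at_right 0)"
proof -
  from ne obtain J0 where J0: "J0 \<in> feasible_flows G f" by blast
  define C where "C = (\<Sum>e\<in>parcs G. c e * J0 e)"
  define M where "M = (\<Sum>e\<in>parcs G. (J0 e)\<^sup>2) / 2"
  have "\<forall>\<^sub>F \<alpha> in at_right 0. norm (\<alpha> * qp_flow G c f \<alpha> e) \<le> sqrt (2 * \<alpha> * (C + \<alpha> * M))"
    using eventually_at_right_less[of 0]
  proof eventually_elim
    case (elim \<alpha>)
    define J where "J = qp_flow G c f \<alpha>"
    have JF: "J \<in> feasible_flows G f" and le: "qp_objective G c \<alpha> J \<le> qp_objective G c \<alpha> J0"
      using qp_solution_qp_flow[OF fin c elim ne] J0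
      by (auto simp: J_def qp_solution_def is_arg_min_linorder)
    have "0 \<le> (\<Sum>e\<in>parcs G. c e * J e)"
      using c JF by (intro sum_nonneg) (auto simp: feasible_flows_def)
    then have "\<alpha> / 2 * (\<Sum>e\<in>parcs G. (J e)\<^sup>2) \<le> C + \<alpha> * M"
      using le by (simp add: qp_objective_altdef C_def M_def)
    moreover have "\<alpha> / 2 * (J e)\<^sup>2 \<le> \<alpha> / 2 * (\<Sum>e\<in>parcs G. (J e)\<^sup>2)"
      using elim fin e by (intro mult_left_mono member_le_sum) auto
    ultimately have "\<alpha> / 2 * (J e)\<^sup>2 \<le> C + \<alpha> * M"
      by linarith
    then have "2 * \<alpha> * (\<alpha> / 2 * (J e)\<^sup>2) \<le> 2 * \<alpha> * (C + \<alpha> * M)"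
      by (rule mult_left_mono) (use elim in simp)
    then have "(\<alpha> * J e)\<^sup>2 \<le> 2 * \<alpha> * (C + \<alpha> * M)"
      by (simp add: power2_eq_square mult_ac)
    then show ?case
      using real_le_rsqrt[of "\<bar>\<alpha> * J e\<bar>"] by (simp add: J_def)
  qed
  moreover have "((\<lambda>\<alpha>. sqrt (2 * \<alpha> * (C + \<alpha> * M))) \<longlongrightarrow> sqrt (2 * 0 * (C + 0 * M))) (at_right 0)"
    by (intro tendsto_intros)
  then have "((\<lambda>\<alpha>. sqrt (2 * \<alpha> * (C + \<alpha> * M))) \<longlongrightarrow> 0) (at_right 0)"
    by (simp only: mult_zero_left mult_zero_right real_sqrt_zero)
  ultimately show ?thesis
    by (rule Lim_null_comparison)
qed

text \<open>
  The smallness threshold is obtained for one support \<open>S\<close> at a time, with a descent direction that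
  does not vary with \<open>\<alpha>\<close>.
\<close>

lemma eventually_lp_solution_if_support:
  assumes fin: "finite (parcs G)" and c: "\<forall>e\<in>parcs G. 0 \<le> c e"
    and ne: "feasible_flows G f \<noteq> {}"
  shows "\<forall>\<^sub>F \<alpha> in at_right 0.
    flow_support G (qp_flow G c f \<alpha>) = S \<longrightarrow> lp_solution G c f (qp_flow G c f \<alpha>)"
proof (cases "\<exists>d\<in>flow_directions G S. (\<Sum>e\<in>parcs G. c e * d e) < 0")
  case True
  then obtain d where d: "d \<in> flow_directions G S" and neg: "(\<Sum>e\<in>parcs G. c e * d e) < 0"
    by blast
  have "((\<lambda>\<alpha>. (\<Sum>e\<in>parcs G. c e * d e) + (\<Sum>e\<in>parcs G. \<alpha> * qp_flow G c f \<alpha> e * d e))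
      \<longlongrightarrow> (\<Sum>e\<in>parcs G. c e * d e) + (\<Sum>e\<in>parcs G. 0 * d e)) (at_right 0)"
    by (intro tendsto_intros scaled_qp_flow_tendsto_0[OF fin c ne])
  then have "\<forall>\<^sub>F \<alpha> in at_right 0.
      (\<Sum>e\<in>parcs G. c e * d e) + (\<Sum>e\<in>parcs G. \<alpha> * qp_flow G c f \<alpha> e * d e) < 0"
    by (rule order_tendstoD(2)) (simp add: neg)
  with eventually_at_right_less[of 0] show ?thesis
  proof eventually_elim
    case (elim \<alpha>)
    \<comment> \<open>The support of the minimizer differs from \<open>S\<close>, as \<open>d\<close> would be a direction of descent.\<close>
    then show ?case
      using qp_first_order[OF fin qp_solution_qp_flow[OF fin c elim(1) ne], of d] d
      by (auto simp: sum_distrib_left mult.assoc)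
  qed
next
  case False
  show ?thesis
    using eventually_at_right_less[of 0]
  proof eventually_elim
    case (elim \<alpha>)
    have "qp_flow G c f \<alpha> \<in> feasible_flows G f"
      using qp_solution_qp_flow[OF fin c elim ne] by (simp add: qp_solution_def is_arg_min_def)
    then show ?case
      using False cheaper_flow_difference_is_direction by metis
  qed
qed

theorem proposition4:
  fixes G :: "'v pair_pre_digraph"
    and c :: "'v \<times> 'v \<Rightarrow> real"
    and \<rho>\<^sub>0 \<rho>\<^sub>1 f :: "'v \<Rightarrow> real"
  assumes "pair_digraph G"
    and "Digraph_Component.connected (with_proj G)"
    and "c \<in> parcs G \<rightarrow>\<^sub>E {0..}"
    and "\<rho>\<^sub>0 \<in> Prob (pverts G)"
    and "\<rho>\<^sub>1 \<in> Prob (pverts G)"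
    and "f = (\<lambda>v\<in>pverts G. \<rho>\<^sub>1 v - \<rho>\<^sub>0 v)"
    and "feasible_flows G f \<noteq> {}"
  shows "\<exists>\<alpha>'>0. \<forall>\<alpha>\<in>{0<..<\<alpha>'}. lp_solution G c f (qp_flow G c f \<alpha>)"
proof -
  interpret pair_digraph G by fact
  have fin: "finite (parcs G)" by (rule pair_finite_arcs)
  have c: "\<forall>e\<in>parcs G. 0 \<le> c e" using assms(3) by (auto simp: PiE_iff)
  have "\<forall>\<^sub>F \<alpha> in at_right 0. \<forall>S\<in>Pow (parcs G).
      flow_support G (qp_flow G c f \<alpha>) = S \<longrightarrow> lp_solution G c f (qp_flow G c f \<alpha>)"
    using fin eventually_lp_solution_if_support[OF fin c assms(7)]
    by (intro eventually_ball_finite) auto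
  then have "\<forall>\<^sub>F \<alpha> in at_right 0. lp_solution G c f (qp_flow G c f \<alpha>)"
    by eventually_elim (auto simp: flow_support_def)
  then show ?thesis
    by (auto simp: eventually_at_right_field)
qed

end
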